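(* Let $P$ and $\widetilde P$ be stochastic matrices indexed by $\mathbb F$, each irreducible and positive recurrent, and let $\pi$ be the stationary probability vector of $P$. Suppose that $\widetilde P\in\mathsf{BM}_d$ and $P\prec_d\widetilde P$. Suppose further that there exist a real column vector $v'=(v'(k,i))_{(k,i)\in\mathbb F}$ with $v'(k,i)\ge1$ and $v'(k,i)\le v'(k+1,i)$ for all $(k,i)\in\mathbb F$, and $\gamma'\in(0,1)$, $b'\in(0,\infty)$, $K\in\mathbb Z_+$, such that $$\widetilde Pv'\le\gamma'v'+b'\,\mathbf 1_K,\qquad \widetilde P(K;0)e>0 .$$ Let $B\in(0,\infty)$ be such that $B\cdot\widetilde P(K;0)e\ge b'e$, and set $$\gamma=\frac{\gamma'+B}{1+B},\qquad b=b'+B,\qquad v(k,i)=\begin{cases}v'(0,i),&k=0,\ i\in\mathbb D,\\ v'(k,i)+B,&k\in\mathbb N,\ i\in\mathbb D.\end{cases}$$ Then for all $n\in\mathbb N$ and all $m\in\mathbb N$, $$\left\|{}_{(n)}\pi_n-\pi\right\|\le \frac{b}{1-\gamma}\left(4\gamma^m+2m\sum_{i\in\mathbb D}\frac{1}{v(n,i)}\right).$$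
   Context: Notation: $\mathbb N=\{1,2,\dots\}$, $\mathbb Z_+=\{0,1,2,\dots\}$, $d\in\mathbb N$, $\mathbb D=\{1,\dots,d\}$, $\mathbb F=\mathbb Z_+\times\mathbb D$. Vector and matrix inequalities (including strict ones) are entrywise; $e$ is the column vector of ones of appropriate dimension. $P=(p(k,i;l,j))$ and $\widetilde P=(\widetilde p(k,i;l,j))$ with $(k,i),(l,j)\in\mathbb F$; $\widetilde P(k;l)$ is the $d\times d$ block $(\widetilde p(k,i;l,j))_{i,j\in\mathbb D}$. $\widetilde P\in\mathsf{BM}_d$ (block-monotone with block size $d$) means $\sum_{m\ge l}\widetilde p(k,i;m,j)\le\sum_{m\ge l}\widetilde p(k+1,i;m,j)$ for all $k,l\in\mathbb Z_+$ and $i,j\in\mathbb D$. $P\prec_d\widetilde P$ ($P$ is block-wise dominated by $\widetilde P$) means $\sum_{m\ge l}p(k,i;m,j)\le\sum_{m\ge l}\widetilde p(k,i;m,j)$ for all $k,l\in\mathbb Z_+$ and $i,j\in\mathbb D$. $\mathbf 1_K$ is the column vector indexed by $\mathbb F$ whose $(k,i)$ entry is $1$ if $k\le K$ and $0$ if $k>K$. For $n\in\mathbb N$, the last-column-block-augmented truncation ${}_{(n)}P_n=({}_{(n)}p_n(k,i;l,j))$ of $P$ is the stochastic matrix indexed by $\mathbb F$ with ${}_{(n)}p_n(k,i;l,j)=p(k,i;l,j)$ for $l\le n-1$, ${}_{(n)}p_n(k,i;n,j)=\sum_{m\ge n}p(k,i;m,j)$, and ${}_{(n)}p_n(k,i;l,j)=0$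 for $l>n$. ${}_{(n)}\pi_n=({}_{(n)}\pi_n(k,i))_{(k,i)\in\mathbb F}$ denotes a stationary probability vector of ${}_{(n)}P_n$. $\|x\|=\sum_{(k,i)\in\mathbb F}|x(k,i)|$ for a row vector $x$. *)

theory Defs
  imports "HOL-Analysis.Analysis"
begin

text \<open>
  The phase set \<open>{1, \<dots>, d}\<close> is a type \<open>'d\<close> of class \<open>finite\<close> (with \<open>d = CARD('d) \<ge> 1\<close>), so the
  state space is the full type \<open>nat \<times> 'd\<close> of pairs (level, phase).
  Unconditional sums \<open>infsum\<close> return 0 on families that are not summable; below they are only
  meaningful for families whose summability follows from \<open>stochastic\<close>, or is demanded explicitly.
\<close>

type_synonym 'd vec_F = "nat \<times> 'd \<Rightarrow> real"
type_synonym 'd mat_F = "nat \<times> 'd \<Rightarrow> nat \<times> 'd \<Rightarrow> real"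

definition stochastic :: "('s \<Rightarrow> 's \<Rightarrow> real) \<Rightarrow> bool" where
  "stochastic P \<longleftrightarrow> (\<forall>x y. 0 \<le> P x y) \<and> (\<forall>x. (P x has_sum 1) UNIV)"

primrec mat_power :: "('s \<Rightarrow> 's \<Rightarrow> real) \<Rightarrow> nat \<Rightarrow> 's \<Rightarrow> 's \<Rightarrow> real" where
  "mat_power P 0 x y = (if x = y then 1 else 0)"
| "mat_power P (Suc n) x y = (\<Sum>\<^sub>\<infinity>z. P x z * mat_power P n z y)"

definition irreducible_chain :: "('s \<Rightarrow> 's \<Rightarrow> real) \<Rightarrow> bool" where
  "irreducible_chain P \<longleftrightarrow> (\<forall>x y. \<exists>n. 0 < mat_power P n x y)"

text \<open>
  \<open>first_passage P n x y\<close> is the probability that the chain started in \<open>x\<close> visits \<open>y\<close> for the first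
  time among the times \<open>1, 2, \<dots>\<close> at time \<open>n\<close>; for \<open>x = y\<close> it is the law of the return time.
\<close>

primrec first_passage :: "('s \<Rightarrow> 's \<Rightarrow> real) \<Rightarrow> nat \<Rightarrow> 's \<Rightarrow> 's \<Rightarrow> real" where
  "first_passage P 0 x y = 0"
| "first_passage P (Suc n) x y =
     (if n = 0 then P x y else (\<Sum>\<^sub>\<infinity>z\<in>- {y}. P x z * first_passage P n z y))"

text \<open>Every state is revisited with probability one and has a finite mean return time.\<close>

definition positive_recurrent :: "('s \<Rightarrow> 's \<Rightarrow> real) \<Rightarrow> bool" where
  "positive_recurrent P \<longleftrightarrow>
     (\<forall>x. (\<lambda>n. first_passage P n x x) sums 1 \<and>
          summable (\<lambda>n. real n * first_passage P n x x))"

definition stationary_prob :: "('s \<Rightarrow> 's \<Rightarrow> real) \<Rightarrow> ('s \<Rightarrow> real) \<Rightarrow> bool" where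
  "stationary_prob P \<mu> \<longleftrightarrow>
     (\<forall>x. 0 \<le> \<mu> x) \<and> (\<mu> has_sum 1) UNIV \<and>
     (\<forall>y. ((\<lambda>x. \<mu> x * P x y) has_sum \<mu> y) UNIV)"

definition block_monotone :: "('d::finite) mat_F \<Rightarrow> bool" where
  "block_monotone P \<longleftrightarrow>
     (\<forall>k l i j. (\<Sum>\<^sub>\<infinity>m\<in>{l..}. P (k, i) (m, j)) \<le> (\<Sum>\<^sub>\<infinity>m\<in>{l..}. P (Suc k, i) (m, j)))"

definition block_dominated :: "('d::finite) mat_F \<Rightarrow> 'd mat_F \<Rightarrow> bool" where
  "block_dominated P Q \<longleftrightarrow>
     (\<forall>k l i j. (\<Sum>\<^sub>\<infinity>m\<in>{l..}. P (k, i) (m, j)) \<le> (\<Sum>\<^sub>\<infinity>m\<in>{l..}. Q (k, i) (m, j)))"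

definition lcb_truncation :: "nat \<Rightarrow> ('d::finite) mat_F \<Rightarrow> 'd mat_F" where
  "lcb_truncation n P = (\<lambda>x (l, j).
     if l < n then P x (l, j)
     else if l = n then (\<Sum>\<^sub>\<infinity>m\<in>{n..}. P x (m, j))
     else 0)"

definition ind_upto :: "nat \<Rightarrow> ('d::finite) vec_F" where
  "ind_upto K = (\<lambda>(k, i). if k \<le> K then 1 else 0)"

text \<open>
  \<open>mat_vec_le Q u w\<close> is the entrywise inequality \<open>Q u \<le> w\<close>, which includes that the series defining
  the entries of \<open>Q u\<close> converge.
\<close>

definition mat_vec_le :: "('d::finite) mat_F \<Rightarrow> 'd vec_F \<Rightarrow> 'd vec_F \<Rightarrow> bool" where
  "mat_vec_le Q u w \<longleftrightarrow>
     (\<forall>x. (\<lambda>y. Q x y * u y) summable_on UNIV \<and> (\<Sum>\<^sub>\<infinity>y. Q x y * u y) \<le> w x)"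

definition norm_F :: "('d::finite) vec_F \<Rightarrow> real" where
  "norm_F u = (\<Sum>\<^sub>\<infinity>x. \<bar>u x\<bar>)"

end

theory Submission
  imports Defs
begin

text \<open>
  Put \<open>h\<^sub>t = P\<^sup>t g\<close> for a sign vector \<open>g\<close>. Since \<open>\<pi>n\<close> is invariant under the truncation, each step
  from \<open>\<pi>n h\<^sub>t\<close> to \<open>\<pi>n h\<^sub>t\<^sub>+\<^sub>1\<close> costs at most twice the mass of \<open>\<pi>n\<close> on level \<open>n\<close>, which is at most
  \<open>\<pi>n v\<close> times the sum of the \<open>1 / v (n, i)\<close>, and \<open>\<pi>n v \<le> b / (1 - \<gamma>)\<close> by the drift condition
  \<open>Pt v \<le> \<gamma> v + b 1\<^sub>0\<close>. The vectors \<open>\<pi>n\<close> and \<open>\<pi>\<close> have the same phase marginal, so \<open>\<pi>n h\<^sub>m\<close> and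
  \<open>\<pi> h\<^sub>m\<close> can both be compared with the average of \<open>h\<^sub>m\<close> over level \<open>0\<close>. This costs
  \<open>2 \<gamma>\<^sup>m \<pi>n v + 2 \<gamma>\<^sup>m \<pi> v\<close>, because \<open>h\<^sub>m (k, i)\<close> and \<open>h\<^sub>m (0, i)\<close> differ by at most
  \<open>2 \<gamma>\<^sup>m v (k, i)\<close>.
\<close>

subsection \<open>Expectations with respect to probability vectors\<close>

definition prob_vec :: "('s \<Rightarrow> real) \<Rightarrow> bool" where
  "prob_vec \<mu> \<longleftrightarrow> (\<forall>x. 0 \<le> \<mu> x) \<and> (\<mu> has_sum 1) UNIV"

text \<open>A divergent sum takes the default value 0 of \<open>infsum\<close>. Hence additivity and
  monotonicity below carry summability premises, while negation and scaling hold without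
  them.\<close>

definition expect :: "('s \<Rightarrow> real) \<Rightarrow> ('s \<Rightarrow> real) \<Rightarrow> real" where
  "expect \<mu> f = (\<Sum>\<^sub>\<infinity>x. \<mu> x * f x)"

lemma stochastic_iff: "stochastic Q \<longleftrightarrow> (\<forall>x. prob_vec (Q x))"
  by (auto simp: stochastic_def prob_vec_def)

lemma stochastic_prob_vec: "stochastic Q \<Longrightarrow> prob_vec (Q x)"
  by (simp only: stochastic_iff)

lemma stationary_prob_imp_prob_vec: "stationary_prob Q \<mu> \<Longrightarrow> prob_vec \<mu>"
  by (auto simp: stationary_prob_def prob_vec_def)

lemma prob_vec_nonneg: "prob_vec \<mu> \<Longrightarrow> 0 \<le> \<mu> x"
  by (simp add: prob_vec_def)

lemma prob_vec_summable: "prob_vec \<mu> \<Longrightarrow> \<mu> summable_on A"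
  by (metis prob_vec_def has_sum_imp_summable summable_on_subset_banach subset_UNIV)

lemma expect_summable_bounded:
  assumes "prob_vec \<mu>" and "\<And>x. \<bar>f x\<bar> \<le> C"
  shows "(\<lambda>x. \<mu> x * f x) summable_on UNIV"
proof -
  have "(\<lambda>x. \<bar>\<mu> x * f x\<bar>) summable_on UNIV"
  proof (rule summable_on_comparison_test)
    show "(\<lambda>x. \<mu> x * C) summable_on UNIV"
      using prob_vec_summable[OF assms(1)] by (rule summable_on_cmult_left)
    show "\<bar>\<mu> x * f x\<bar> \<le> \<mu> x * C" for x
      using assms prob_vec_nonneg[OF assms(1), of x] by (auto simp: abs_mult intro!: mult_left_mono)
  qed auto
  then show ?thesis
    using summable_on_iff_abs_summable_on_real by fastforce
qed

lemma expect_const: "prob_vec \<mu> \<Longrightarrow> expect \<mu> (\<lambda>_. c) = c"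
  unfolding expect_def prob_vec_def
  by (metis infsumI has_sum_cmult_left mult_1)

lemma expect_uminus: "expect \<mu> (\<lambda>x. - f x) = - expect \<mu> f"
  by (simp add: expect_def infsum_uminus)

lemma expect_mono_summable:
  assumes "prob_vec \<mu>" and "(\<lambda>x. \<mu> x * f x) summable_on UNIV"
    and "(\<lambda>x. \<mu> x * g x) summable_on UNIV" and "\<And>x. f x \<le> g x"
  shows "expect \<mu> f \<le> expect \<mu> g"
  unfolding expect_def
  by (rule infsum_mono) (use assms prob_vec_nonneg[OF assms(1)] in \<open>auto intro: mult_left_mono\<close>)

lemma expect_mono:
  assumes "prob_vec \<mu>" and "\<And>x. \<bar>f x\<bar> \<le> C" and "\<And>x. \<bar>g x\<bar> \<le> D" and "\<And>x. f x \<le> g x"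
  shows "expect \<mu> f \<le> expect \<mu> g"
  using assms by (intro expect_mono_summable expect_summable_bounded)

lemma expect_add:
  assumes "(\<lambda>x. \<mu> x * f x) summable_on UNIV" and "(\<lambda>x. \<mu> x * g x) summable_on UNIV"
  shows "expect \<mu> (\<lambda>x. f x + g x) = expect \<mu> f + expect \<mu> g"
  using infsum_add[OF assms] by (simp add: expect_def distrib_left)

lemma expect_diff:
  assumes "(\<lambda>x. \<mu> x * f x) summable_on UNIV" and "(\<lambda>x. \<mu> x * g x) summable_on UNIV"
  shows "expect \<mu> (\<lambda>x. f x - g x) = expect \<mu> f - expect \<mu> g"
proof -
  have "(\<lambda>x. \<mu> x * - g x) summable_on UNIV"
    using assms(2) by (simp add: summable_on_uminus)
  from expect_add[OF assms(1) this] show ?thesis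
    by (simp add: expect_uminus)
qed

lemma expect_cmult: "expect \<mu> (\<lambda>x. c * f x) = c * expect \<mu> f"
proof -
  have "(\<lambda>x. \<mu> x * (c * f x)) = (\<lambda>x. c * (\<mu> x * f x))"
    by (simp add: mult_ac)
  then show ?thesis
    by (simp add: expect_def infsum_cmult_right')
qed

lemma abs_expect_le:
  assumes "prob_vec \<mu>" and "\<And>x. \<bar>f x\<bar> \<le> C"
  shows "\<bar>expect \<mu> f\<bar> \<le> C"
proof -
  have "f x \<le> C" "- C \<le> f x" for x
    using assms(2)[of x] by auto
  then have "expect \<mu> f \<le> expect \<mu> (\<lambda>_. C)" "expect \<mu> (\<lambda>_. - C) \<le> expect \<mu> f"
    using assms by (auto intro!: expect_mono[where C = "\<bar>C\<bar>" and D = "\<bar>C\<bar>"] order_trans[OF assms(2)])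
  then show ?thesis
    using assms(1) by (simp add: expect_const abs_le_iff)
qed

lemma abs_expect_le_expect:
  assumes "prob_vec \<mu>" and "(\<lambda>x. \<mu> x * f x) summable_on UNIV"
    and "(\<lambda>x. \<mu> x * g x) summable_on UNIV" and "\<And>x. \<bar>f x\<bar> \<le> g x"
  shows "\<bar>expect \<mu> f\<bar> \<le> expect \<mu> g"
proof -
  have le: "f x \<le> g x" "- f x \<le> g x" for x
    using assms(4)[of x] by auto
  have "expect \<mu> f \<le> expect \<mu> g"
    using assms(1-3) le(1) by (rule expect_mono_summable)
  moreover have "(\<lambda>x. \<mu> x * - f x) summable_on UNIV"
    using assms(2) by (simp add: summable_on_uminus)
  then have "expect \<mu> (\<lambda>x. - f x) \<le> expect \<mu> g"
    using assms(1,3) le(2) by (intro expect_mono_summable)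
  ultimately show ?thesis
    by (simp add: expect_uminus)
qed

text \<open>Fubini: the double family is dominated by \<open>C\<close> times
  \<open>\<mu> x * Q x y\<close>, which is summable because its row sums are \<open>\<mu> x\<close>.
  Swapping the sums and applying invariance to the inner one gives the claim.\<close>

lemma expect_stationary:
  assumes "stochastic Q" and "stationary_prob Q \<mu>" and f: "\<And>x. \<bar>f x\<bar> \<le> C"
  shows "expect \<mu> (\<lambda>x. expect (Q x) f) = expect \<mu> f"
proof -
  have \<mu>: "prob_vec \<mu>" and Q: "prob_vec (Q x)" for x
    using assms stationary_prob_imp_prob_vec by (auto simp: stochastic_iff)
  let ?F = "\<lambda>(x, y). \<mu> x * Q x y * f y"
  have "(\<lambda>(x, y). \<mu> x * Q x y) summable_on (UNIV \<times> UNIV)"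
  proof (rule summable_on_SigmaI)
    show "((\<lambda>y. (\<lambda>(x, y). \<mu> x * Q x y) (x, y)) has_sum \<mu> x) UNIV" for x
      using Q[of x] has_sum_cmult_right[where f = "Q x" and a = 1 and c = "\<mu> x"] by (simp add: prob_vec_def)
    show "\<mu> summable_on UNIV"
      by (rule prob_vec_summable[OF \<mu>])
  qed (use prob_vec_nonneg[OF \<mu>] prob_vec_nonneg[OF Q] in auto)
  then have "(\<lambda>z. (case z of (x, y) \<Rightarrow> \<mu> x * Q x y) * C) summable_on (UNIV \<times> UNIV)"
    by (rule summable_on_cmult_left)
  then have "(\<lambda>z. \<bar>?F z\<bar>) summable_on (UNIV \<times> UNIV)"
  proof (rule summable_on_comparison_test)
    show "\<bar>?F z\<bar> \<le> (case z of (x, y) \<Rightarrow> \<mu> x * Q x y) * C" for z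
      using f prob_vec_nonneg[OF \<mu>] prob_vec_nonneg[OF Q]
      by (auto simp: abs_mult split: prod.split intro!: mult_left_mono)
  qed auto
  then have F: "?F summable_on (UNIV \<times> UNIV)"
    using summable_on_iff_abs_summable_on_real by fastforce
  have "expect \<mu> (\<lambda>x. expect (Q x) f) = (\<Sum>\<^sub>\<infinity>x. \<Sum>\<^sub>\<infinity>y. \<mu> x * Q x y * f y)"
    by (simp add: expect_def mult.assoc infsum_cmult_right')
  also have "\<dots> = (\<Sum>\<^sub>\<infinity>y. \<Sum>\<^sub>\<infinity>x. \<mu> x * Q x y * f y)"
    by (rule infsum_swap_banach[OF F])
  also have "\<dots> = (\<Sum>\<^sub>\<infinity>y. \<mu> y * f y)"
  proof (rule infsum_cong)
    fix y
    have "(\<Sum>\<^sub>\<infinity>x. \<mu> x * Q x y) = \<mu> y"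
      using assms(2) by (intro infsumI) (simp add: stationary_prob_def)
    then show "(\<Sum>\<^sub>\<infinity>x. \<mu> x * Q x y * f y) = \<mu> y * f y"
      by (simp add: infsum_cmult_left')
  qed
  finally show ?thesis
    by (simp add: expect_def)
qed

text \<open>Applying stationarity to the truncations of \<open>v\<close> avoids assuming that \<open>v\<close> is integrable.\<close>

lemma stationary_expect_drift:
  assumes "stochastic Q" and "stationary_prob Q \<mu>" and "\<gamma> < 1" and "0 \<le> b"
    and v: "\<And>x. 0 \<le> v x"
    and drift: "\<And>N x. 0 \<le> N \<Longrightarrow> expect (Q x) (\<lambda>y. min (v y) N) \<le> \<gamma> * v x + b"
  shows "(\<lambda>x. \<mu> x * v x) summable_on UNIV" and "expect \<mu> v \<le> b / (1 - \<gamma>)"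
proof -
  have \<mu>: "prob_vec \<mu>" and Q: "prob_vec (Q x)" for x
    using assms stationary_prob_imp_prob_vec by (auto simp: stochastic_iff)
  have bound: "(\<Sum>x\<in>F. \<mu> x * v x) \<le> b / (1 - \<gamma>)" if F: "finite F" for F
  proof -
    \<comment> \<open>This level is high enough that cutting \<open>v\<close> off at
      \<open>N\<close> leaves it unchanged on \<open>F\<close>.\<close>
    define N where "N = (\<Sum>x\<in>F. v x)"
    have NF: "v x \<le> N" if "x \<in> F" for x
      using that F v by (auto simp: N_def intro: member_le_sum)
    have N0: "0 \<le> N"
      by (simp add: N_def sum_nonneg v)
    let ?w = "\<lambda>x. min (v x) N"
    let ?Qw = "\<lambda>x. expect (Q x) ?w"
    have w: "\<bar>?w x\<bar> \<le> N" for x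
      using v[of x] N0 by (auto simp: min_def)
    have Qw: "\<bar>?Qw x\<bar> \<le> N" for x
      by (rule abs_expect_le[OF Q w])
    have "0 = expect \<mu> (\<lambda>x. ?w x - ?Qw x)"
      using expect_stationary[OF assms(1,2) w]
        expect_diff[OF expect_summable_bounded[OF \<mu> w] expect_summable_bounded[OF \<mu> Qw]]
      by simp
    then have b: "expect \<mu> (\<lambda>x. (?w x - ?Qw x) + b) = b"
      using expect_add[of \<mu> "\<lambda>x. ?w x - ?Qw x" "\<lambda>_. b"] expect_const[OF \<mu>, of b]
        expect_summable_bounded[OF \<mu>, of "\<lambda>x. ?w x - ?Qw x" "2 * N"]
        expect_summable_bounded[OF \<mu>, of "\<lambda>x. b" "\<bar>b\<bar>"] w Qw
      by (smt (verit, del_insts))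
    have lower: "(1 - \<gamma>) * v x \<le> ?w x - ?Qw x + b" if "x \<in> F" for x
      using drift[OF N0, of x] NF[OF that] by (simp add: algebra_simps)
    \<comment> \<open>Where \<open>v x\<close> is at most \<open>N\<close>, the drift gives this;
      elsewhere \<open>?w x\<close> equals \<open>N\<close>, which bounds \<open>?Qw x\<close>. The
      sign allows a finite sum over \<open>F\<close> to be bounded by the full expectation.\<close>
    have nonneg: "0 \<le> ?w x - ?Qw x + b" for x
    proof (cases "v x \<le> N")
      case True
      have "0 \<le> (1 - \<gamma>) * v x"
        using v[of x] assms(3) by simp
      then show ?thesis
        using True drift[OF N0, of x] by (simp add: algebra_simps)
    next
      case False
      then show ?thesis
        using Qw[of x] assms(4) by simp
    qed
    have "(1 - \<gamma>) * (\<Sum>x\<in>F. \<mu> x * v x) = (\<Sum>x\<in>F. \<mu> x * ((1 - \<gamma>) * v x))"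
      by (simp add: sum_distrib_left mult_ac)
    also have "\<dots> \<le> (\<Sum>x\<in>F. \<mu> x * (?w x - ?Qw x + b))"
      using prob_vec_nonneg[OF \<mu>] by (auto intro!: sum_mono mult_left_mono lower)
    also have "\<dots> \<le> expect \<mu> (\<lambda>x. ?w x - ?Qw x + b)"
      unfolding expect_def[of \<mu>]
    proof (rule finite_sum_le_infsum[OF _ F])
      have "\<bar>?w x - ?Qw x + b\<bar> \<le> 2 * N + \<bar>b\<bar>" for x
        using w[of x] Qw[of x] by linarith
      then show "(\<lambda>x. \<mu> x * (?w x - ?Qw x + b)) summable_on UNIV"
        by (rule expect_summable_bounded[OF \<mu>])
    qed (use prob_vec_nonneg[OF \<mu>] nonneg in auto)
    also have "\<dots> = b"
      by (rule b)
    finally show ?thesis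
      using assms(3) by (simp add: field_simps)
  qed
  have nn: "0 \<le> \<mu> x * v x" for x
    using prob_vec_nonneg[OF \<mu>] v by simp
  show summ: "(\<lambda>x. \<mu> x * v x) summable_on UNIV"
    by (rule nonneg_bdd_above_summable_on) (use nn bound in \<open>auto intro!: bdd_aboveI2\<close>)
  show "expect \<mu> v \<le> b / (1 - \<gamma>)"
    unfolding expect_def by (rule infsum_le_finite_sums[OF summ]) (use bound in auto)
qed

subsection \<open>Level tails and stochastic dominance\<close>

lemma summable_on_level:
  fixes f :: "nat \<times> 'd::finite \<Rightarrow> real"
  assumes "f summable_on UNIV"
  shows "(\<lambda>l. f (l, j)) summable_on A"
proof -
  have "f summable_on (\<lambda>l. (l, j)) ` A"
    using assms by (rule summable_on_subset_banach) auto
  then show ?thesis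
    by (subst (asm) summable_on_reindex) (auto simp: inj_on_def comp_def)
qed

lemma has_sum_by_phase:
  fixes f :: "nat \<times> 'd::finite \<Rightarrow> real"
  assumes "\<And>j. ((\<lambda>l. f (l, j)) has_sum s j) UNIV"
  shows "(f has_sum (\<Sum>j\<in>UNIV. s j)) UNIV"
proof -
  have "(f has_sum s j) (range (\<lambda>l. (l, j)))" for j
    using assms[of j] by (subst has_sum_reindex) (auto simp: inj_on_def comp_def)
  then have "(f has_sum (\<Sum>j\<in>UNIV. s j)) (\<Union>j\<in>UNIV. range (\<lambda>l. (l, j)))"
    by (intro sum_has_sum) auto
  moreover have "(\<Union>j\<in>UNIV. range (\<lambda>l. (l, j))) = (UNIV :: (nat \<times> 'd) set)"
    by auto
  ultimately show ?thesis
    by simp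
qed

lemma infsum_by_phase:
  fixes f :: "nat \<times> 'd::finite \<Rightarrow> real"
  assumes "f summable_on UNIV"
  shows "infsum f UNIV = (\<Sum>j\<in>UNIV. \<Sum>\<^sub>\<infinity>l. f (l, j))"
  using has_sum_by_phase[OF has_sum_infsum[OF summable_on_level[OF assms]]] by (rule infsumI)

lemma infsum_atLeast_Suc:
  fixes c :: "nat \<Rightarrow> real"
  assumes "c summable_on UNIV"
  shows "infsum c {l..} = c l + infsum c {Suc l..}"
proof -
  have "{l..} = insert l {Suc l..}"
    by auto
  then show ?thesis
    using infsum_insert[of c "{Suc l..}" l] summable_on_subset_banach[OF assms, of "{Suc l..}"] by simp
qed

lemma tail_tendsto_0:
  fixes c :: "nat \<Rightarrow> real"
  assumes c: "c summable_on UNIV"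
  shows "(\<lambda>N. infsum c {N..}) \<longlonglongrightarrow> 0"
proof -
  have eq: "infsum c {N..} = infsum c UNIV - sum c {..<N}" for N
  proof (induction N)
    case (Suc N)
    then show ?case
      using infsum_atLeast_Suc[OF c, of N] by simp
  qed simp
  have "(\<lambda>N. sum c {..<N}) \<longlonglongrightarrow> infsum c UNIV"
    using has_sum_imp_sums[OF has_sum_infsum[OF c]] by (simp add: sums_def)
  then have "(\<lambda>N. infsum c UNIV - sum c {..<N}) \<longlonglongrightarrow> infsum c UNIV - infsum c UNIV"
    by (intro tendsto_intros)
  then show ?thesis
    by (simp add: eq)
qed

text \<open>Summation by parts.\<close>

lemma infsum_mult_mono_nonneg:
  fixes c f :: "nat \<Rightarrow> real"
  assumes c: "c summable_on UNIV" and total: "infsum c UNIV = 0" and tail: "\<And>l. 0 \<le> infsum c {l..}"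
    and f: "mono f" and bnd: "\<And>l. \<bar>f l\<bar> \<le> C" and cf: "(\<lambda>l. c l * f l) summable_on UNIV"
  shows "0 \<le> (\<Sum>\<^sub>\<infinity>l. c l * f l)"
proof -
  let ?T = "\<lambda>N. infsum c {N..}"
  \<comment> \<open>With the boundary term included, the sum starts at 0 because \<open>c\<close>
    has total 0, and passing from \<open>N\<close> to \<open>Suc N\<close> adds
    \<open>?T (Suc N) * (f (Suc N) - f N)\<close>.\<close>
  have partial: "0 \<le> (\<Sum>l<N. c l * f l) + ?T N * f N" for N
  proof (induction N)
    case (Suc N)
    have "0 \<le> ?T (Suc N) * (f (Suc N) - f N)"
      using tail[of "Suc N"] monoD[OF f, of N "Suc N"] by simp
    with Suc show ?case
      using infsum_atLeast_Suc[OF c, of N] by (simp add: algebra_simps)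
  qed (use total in simp)
  have "(\<lambda>N. \<Sum>l<N. c l * f l) \<longlonglongrightarrow> (\<Sum>\<^sub>\<infinity>l. c l * f l)"
    using has_sum_imp_sums[OF has_sum_infsum[OF cf]] by (simp add: sums_def)
  moreover have "(\<lambda>N. ?T N * f N) \<longlonglongrightarrow> 0"
  proof (rule tendsto_0_le[where K = C])
    show "?T \<longlonglongrightarrow> 0"
      by (rule tail_tendsto_0[OF c])
    show "\<forall>\<^sub>F N in sequentially. norm (?T N * f N) \<le> norm (?T N) * C"
      using bnd by (intro always_eventually) (auto simp: abs_mult intro: mult_left_mono)
  qed
  ultimately have "(\<lambda>N. (\<Sum>l<N. c l * f l) + ?T N * f N) \<longlonglongrightarrow> (\<Sum>\<^sub>\<infinity>l. c l * f l) + 0"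
    by (intro tendsto_add)
  then show ?thesis
    using partial by (intro LIMSEQ_le_const[where X = "\<lambda>N. (\<Sum>l<N. c l * f l) + ?T N * f N"]) auto
qed

text \<open>The common form of the two block relations: \<open>block_monotone\<close> compares
  consecutive rows of one matrix in this sense, and \<open>block_dominated\<close> compares equal
  rows of two matrices.\<close>

definition row_dominated :: "('d::finite) vec_F \<Rightarrow> 'd vec_F \<Rightarrow> bool" where
  "row_dominated \<mu> \<nu> \<longleftrightarrow> (\<forall>l j. (\<Sum>\<^sub>\<infinity>m\<in>{l..}. \<mu> (m, j)) \<le> (\<Sum>\<^sub>\<infinity>m\<in>{l..}. \<nu> (m, j)))"

definition level_mono :: "('d::finite) vec_F \<Rightarrow> bool" where
  "level_mono f \<longleftrightarrow> (\<forall>k i. f (k, i) \<le> f (Suc k, i))"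

definition phase_mass :: "('d::finite) vec_F \<Rightarrow> 'd \<Rightarrow> real" where
  "phase_mass \<mu> j = (\<Sum>\<^sub>\<infinity>l. \<mu> (l, j))"

lemma row_dominatedD:
  "row_dominated \<mu> \<nu> \<Longrightarrow> (\<Sum>\<^sub>\<infinity>m\<in>{l..}. \<mu> (m, j)) \<le> (\<Sum>\<^sub>\<infinity>m\<in>{l..}. \<nu> (m, j))"
  by (simp add: row_dominated_def)

lemma row_dominated_trans: "row_dominated \<mu> \<nu> \<Longrightarrow> row_dominated \<nu> \<rho> \<Longrightarrow> row_dominated \<mu> \<rho>"
  unfolding row_dominated_def by (meson order_trans)

lemma row_dominated_refl: "row_dominated \<mu> \<mu>"
  by (simp add: row_dominated_def)

lemma level_monoD:
  assumes "level_mono f" and "k \<le> l"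
  shows "f (k, i) \<le> f (l, i)"
  using lift_Suc_mono_le[of "\<lambda>k. f (k, i)"] assms by (simp add: level_mono_def)

lemma sum_phase_mass: "prob_vec \<mu> \<Longrightarrow> (\<Sum>j\<in>UNIV. phase_mass \<mu> j) = 1"
  unfolding phase_mass_def
  by (metis infsum_by_phase infsumI prob_vec_def has_sum_imp_summable)

lemma phase_mass_nonneg: "prob_vec \<mu> \<Longrightarrow> 0 \<le> phase_mass \<mu> j"
  unfolding phase_mass_def by (rule infsum_nonneg) (simp add: prob_vec_nonneg)

lemma phase_mass_ge:
  assumes "prob_vec \<mu>"
  shows "\<mu> (l, j) \<le> phase_mass \<mu> j"
  unfolding phase_mass_def
  using finite_sum_le_infsum[of "\<lambda>l. \<mu> (l, j)" UNIV "{l}"]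
    summable_on_level[OF prob_vec_summable[OF assms]] prob_vec_nonneg[OF assms]
  by auto

text \<open>At \<open>l = 0\<close> domination compares the phase marginals entrywise. Both add up
  to 1, so no inequality can be strict.\<close>

lemma row_dominated_phase_mass_eq:
  assumes "prob_vec \<mu>" and "prob_vec \<nu>" and "row_dominated \<mu> \<nu>"
  shows "phase_mass \<mu> = phase_mass \<nu>"
proof
  fix j
  have le: "phase_mass \<mu> j \<le> phase_mass \<nu> j" for j
    using row_dominatedD[OF assms(3), where l = 0 and j = j] by (simp add: phase_mass_def)
  show "phase_mass \<mu> j = phase_mass \<nu> j"
    using sum_mono_inv[of "phase_mass \<mu>" UNIV "phase_mass \<nu>" j] le
      sum_phase_mass[OF assms(1)] sum_phase_mass[OF assms(2)]
    by auto
qed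

text \<open>Within each phase the difference of the two vectors has nonnegative tails, and total 0
  because the marginals agree; summation by parts then applies to \<open>f\<close> along that phase,
  whatever its sign.\<close>

lemma expect_level_mono_le:
  assumes \<mu>: "prob_vec \<mu>" and \<nu>: "prob_vec \<nu>" and dom: "row_dominated \<mu> \<nu>"
    and f: "level_mono f" and bnd: "\<And>x. \<bar>f x\<bar> \<le> C"
  shows "expect \<mu> f \<le> expect \<nu> f"
proof -
  have s: "(\<lambda>x. \<mu> x * f x) summable_on UNIV" "(\<lambda>x. \<nu> x * f x) summable_on UNIV"
    using expect_summable_bounded \<mu> \<nu> bnd by blast+
  have level: "(\<Sum>\<^sub>\<infinity>l. \<mu> (l, j) * f (l, j)) \<le> (\<Sum>\<^sub>\<infinity>l. \<nu> (l, j) * f (l, j))" for j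
  proof -
    have sm: "(\<lambda>l. - \<mu> (l, j)) summable_on A" "(\<lambda>l. \<nu> (l, j)) summable_on A" for A
      using summable_on_level[OF prob_vec_summable[OF \<mu>]] summable_on_level[OF prob_vec_summable[OF \<nu>]]
      by (simp_all add: summable_on_uminus)
    let ?c = "\<lambda>l. \<nu> (l, j) - \<mu> (l, j)"
    have c: "?c summable_on A" for A
      using summable_on_add[OF sm(2,1)] by simp
    have tail: "infsum ?c A = (\<Sum>\<^sub>\<infinity>l\<in>A. \<nu> (l, j)) - (\<Sum>\<^sub>\<infinity>l\<in>A. \<mu> (l, j))" for A
      using infsum_add[OF sm(2,1), of A] by (simp add: infsum_uminus)
    have sf: "(\<lambda>l. \<nu> (l, j) * f (l, j)) summable_on UNIV" "(\<lambda>l. - (\<mu> (l, j) * f (l, j))) summable_on UNIV"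
      by (simp_all add: summable_on_uminus summable_on_level[OF s(1)] summable_on_level[OF s(2)])
    have "0 \<le> (\<Sum>\<^sub>\<infinity>l. ?c l * f (l, j))"
    proof (rule infsum_mult_mono_nonneg[OF c])
      show "infsum ?c UNIV = 0"
        using row_dominated_phase_mass_eq[OF \<mu> \<nu> dom] by (simp add: tail phase_mass_def fun_eq_iff)
      show "0 \<le> infsum ?c {l..}" for l
        using dom by (simp add: tail row_dominated_def)
      show "mono (\<lambda>l. f (l, j))"
        using level_monoD[OF f] by (simp add: mono_def)
      show "\<bar>f (l, j)\<bar> \<le> C" for l
        by (rule bnd)
      show "(\<lambda>l. ?c l * f (l, j)) summable_on UNIV"
        using summable_on_add[OF sf] by (simp add: left_diff_distrib)
    qed
    then show ?thesis
      using infsum_add[OF sf] by (simp add: left_diff_distrib infsum_uminus)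
  qed
  show ?thesis
    unfolding expect_def infsum_by_phase[OF s(1)] infsum_by_phase[OF s(2)]
    by (intro sum_mono level)
qed

lemma expect_phase:
  fixes \<mu> :: "('d::finite) vec_F"
  assumes "prob_vec \<mu>"
  shows "expect \<mu> (\<lambda>x. c (snd x)) = (\<Sum>j\<in>UNIV. phase_mass \<mu> j * c j)"
proof -
  have "\<bar>c j\<bar> \<le> (\<Sum>j\<in>UNIV. \<bar>c j\<bar>)" for j
    by (rule member_le_sum) auto
  then have "(\<lambda>x. \<mu> x * c (snd x)) summable_on UNIV"
    by (intro expect_summable_bounded[OF assms])
  from infsum_by_phase[OF this] show ?thesis
    by (simp add: expect_def phase_mass_def infsum_cmult_left')
qed

lemma expect_level:
  fixes \<mu> :: "('d::finite) vec_F"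
  assumes "prob_vec \<mu>"
  shows "expect \<mu> (\<lambda>x. if fst x \<in> A then 1 else 0) = (\<Sum>j\<in>UNIV. \<Sum>\<^sub>\<infinity>l\<in>A. \<mu> (l, j))"
proof -
  have "(\<lambda>x. \<mu> x * (if fst x \<in> A then 1 else 0)) summable_on UNIV"
    by (rule expect_summable_bounded[OF assms, where C = 1]) auto
  moreover have "(\<Sum>\<^sub>\<infinity>l. \<mu> (l, j) * (if l \<in> A then 1 else 0)) = (\<Sum>\<^sub>\<infinity>l\<in>A. \<mu> (l, j))" for j
    by (rule infsum_cong_neutral) auto
  ultimately show ?thesis
    by (simp add: expect_def infsum_by_phase)
qed

subsection \<open>The truncated chain\<close>

text \<open>The augmentation moves the mass beyond level \<open>n\<close> down to level
  \<open>n\<close> within the same phase, so tails starting at or below \<open>n\<close> are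
  unchanged. The induction runs downwards from \<open>l = n\<close>.\<close>

lemma infsum_lcb_truncation_atLeast:
  fixes P :: "('d::finite) mat_F"
  assumes "stochastic P"
  shows "(\<Sum>\<^sub>\<infinity>m\<in>{l..}. lcb_truncation n P x (m, j)) =
    (if l \<le> n then \<Sum>\<^sub>\<infinity>m\<in>{l..}. P x (m, j) else 0)"
proof -
  let ?R = "\<lambda>m. lcb_truncation n P x (m, j)"
  have P: "(\<lambda>m. P x (m, j)) summable_on UNIV"
    using assms by (intro summable_on_level prob_vec_summable stochastic_prob_vec)
  have "{m. ?R m \<noteq> 0} \<subseteq> {..n}"
    by (auto simp: lcb_truncation_def split: if_splits)
  then have R: "?R summable_on UNIV"
    by (intro finite_nonzero_values_imp_summable_on) (auto intro: finite_subset)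
  have above: "infsum ?R {l..} = 0" if "n < l" for l
    using that by (intro infsum_0) (auto simp: lcb_truncation_def)
  have "infsum ?R {l..} = (\<Sum>\<^sub>\<infinity>m\<in>{l..}. P x (m, j))" if "l \<le> n"
    using that
  proof (induction rule: inc_induct)
    case base
    then show ?case
      using infsum_atLeast_Suc[OF R, of n] above[of "Suc n"] by (simp add: lcb_truncation_def)
  next
    case (step l)
    then show ?case
      using infsum_atLeast_Suc[OF R, of l] infsum_atLeast_Suc[OF P, of l]
      by (simp add: lcb_truncation_def)
  qed
  with above show ?thesis
    by simp
qed

lemma lcb_truncation_nonneg:
  fixes P :: "('d::finite) mat_F"
  assumes "stochastic P"
  shows "0 \<le> lcb_truncation n P x y"
  by (auto simp: lcb_truncation_def split: prod.split
      intro!: infsum_nonneg prob_vec_nonneg[OF stochastic_prob_vec[OF assms]])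

lemma stochastic_lcb_truncation:
  fixes P :: "('d::finite) mat_F"
  assumes "stochastic P"
  shows "stochastic (lcb_truncation n P)"
proof -
  have "(lcb_truncation n P x has_sum 1) UNIV" for x
  proof -
    have "(\<lambda>m. lcb_truncation n P x (m, j)) summable_on UNIV" for j
      by (rule finite_nonzero_values_imp_summable_on, rule finite_subset[of _ "{..n}"])
        (auto simp: lcb_truncation_def split: if_splits)
    then have "((\<lambda>m. lcb_truncation n P x (m, j)) has_sum phase_mass (P x) j) UNIV" for j
      using infsum_lcb_truncation_atLeast[OF assms, where l = 0]
      by (simp add: has_sum_iff phase_mass_def)
    then have "(lcb_truncation n P x has_sum (\<Sum>j\<in>UNIV. phase_mass (P x) j)) UNIV"
      by (rule has_sum_by_phase)
    then show ?thesis
      using assms by (simp add: sum_phase_mass stochastic_prob_vec)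
  qed
  then show ?thesis
    using lcb_truncation_nonneg[OF assms] by (simp add: stochastic_def)
qed

lemma row_dominated_lcb_truncation:
  fixes P :: "('d::finite) mat_F"
  assumes "stochastic P"
  shows "row_dominated (lcb_truncation n P x) (P x)"
  by (auto simp: row_dominated_def infsum_lcb_truncation_atLeast[OF assms]
      intro!: infsum_nonneg prob_vec_nonneg[OF stochastic_prob_vec[OF assms]])

text \<open>The two rows agree below level \<open>n\<close> and give the same mass to the levels
  from \<open>n\<close> on, which the truncated row carries on level \<open>n\<close> alone. Each
  row contributes at most this mass, whence the factor 2.\<close>

lemma abs_expect_lcb_truncation_diff_le:
  fixes P :: "('d::finite) mat_F"
  assumes P: "stochastic P" and f: "\<And>x. \<bar>f x\<bar> \<le> 1"
  shows "\<bar>expect (lcb_truncation n P x) f - expect (P x) f\<bar>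
    \<le> 2 * expect (lcb_truncation n P x) (\<lambda>y. if fst y = n then 1 else 0)"
proof -
  let ?R = "lcb_truncation n P x"
  have pv: "prob_vec (P x)" "prob_vec ?R"
    using P stochastic_lcb_truncation[OF P] by (auto intro: stochastic_prob_vec)
  define f1 f2 tl where "f1 = (\<lambda>y. if fst y < n then f y else 0)"
    and "f2 = (\<lambda>y. if fst y < n then 0 else f y)"
    and "tl = (\<lambda>y :: nat \<times> 'd. if fst y \<in> {n..} then 1 else 0 :: real)"
  have bd: "\<bar>f1 y\<bar> \<le> 1" "\<bar>f2 y\<bar> \<le> 1" "\<bar>tl y\<bar> \<le> 1" "\<bar>f2 y\<bar> \<le> tl y" for y
    using f by (auto simp: f1_def f2_def tl_def)
  have split: "expect \<mu> f = expect \<mu> f1 + expect \<mu> f2" if "prob_vec \<mu>" for \<mu>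
  proof -
    have "f = (\<lambda>y. f1 y + f2 y)"
      by (auto simp: f1_def f2_def)
    then show ?thesis
      using expect_add[OF expect_summable_bounded[OF that bd(1)] expect_summable_bounded[OF that bd(2)]]
      by simp
  qed
  have "expect ?R f1 = expect (P x) f1"
    unfolding expect_def by (rule infsum_cong) (auto simp: f1_def lcb_truncation_def)
  moreover have "\<bar>expect \<mu> f2\<bar> \<le> expect \<mu> tl" if "prob_vec \<mu>" for \<mu>
    using expect_summable_bounded[OF that bd(2)] expect_summable_bounded[OF that bd(3)] bd(4)
    by (rule abs_expect_le_expect[OF that])
  from this[OF pv(1)] this[OF pv(2)]
  have "\<bar>expect (P x) f2\<bar> \<le> expect (P x) tl" "\<bar>expect ?R f2\<bar> \<le> expect ?R tl" .
  moreover have "expect (P x) tl = expect ?R tl"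
    unfolding tl_def expect_level[OF pv(1)] expect_level[OF pv(2)]
    by (simp add: infsum_lcb_truncation_atLeast[OF P])
  moreover have "expect ?R tl = expect ?R (\<lambda>y. if fst y = n then 1 else 0)"
    unfolding expect_def by (rule infsum_cong) (auto simp: tl_def lcb_truncation_def)
  ultimately show ?thesis
    using split[OF pv(1)] split[OF pv(2)] by linarith
qed

section \<open>Transition operators and their iterates\<close>

definition transition :: "('s \<Rightarrow> 's \<Rightarrow> real) \<Rightarrow> ('s \<Rightarrow> real) \<Rightarrow> 's \<Rightarrow> real" where
  "transition Q f x = expect (Q x) f"

lemma abs_transition_le:
  "stochastic Q \<Longrightarrow> (\<And>x. \<bar>f x\<bar> \<le> C) \<Longrightarrow> \<bar>transition Q f x\<bar> \<le> C"
  by (simp add: transition_def stochastic_iff abs_expect_le)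

lemma abs_transition_funpow_le:
  assumes "stochastic Q" and "\<And>x. \<bar>f x\<bar> \<le> C"
  shows "\<bar>(transition Q ^^ t) f x\<bar> \<le> C"
proof (induction t arbitrary: x)
  case (Suc t)
  then show ?case
    using abs_transition_le[OF assms(1)] by simp
qed (use assms in simp)

lemma expect_stationary_funpow:
  assumes "stochastic Q" and "stationary_prob Q \<mu>" and "\<And>x. \<bar>f x\<bar> \<le> C"
  shows "expect \<mu> ((transition Q ^^ t) f) = expect \<mu> f"
proof (induction t)
  case (Suc t)
  then show ?case
    using expect_stationary[OF assms(1,2) abs_transition_funpow_le[OF assms(1,3)]]
    by (simp add: transition_def[abs_def])
qed simp

text \<open>Stationarity is used twice: first to replace \<open>f\<close> by its image under the
  truncation, so that the row-wise bound applies, and then to turn the averaged probability of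
  entering level \<open>n\<close> into the mass of \<open>\<mu>\<close> there.\<close>

lemma abs_expect_transition_diff_le:
  fixes P :: "('d::finite) mat_F"
  assumes P: "stochastic P" and \<mu>: "stationary_prob (lcb_truncation n P) \<mu>" and f: "\<And>x. \<bar>f x\<bar> \<le> 1"
  shows "\<bar>expect \<mu> f - expect \<mu> (transition P f)\<bar> \<le> 2 * (\<Sum>j\<in>UNIV. \<mu> (n, j))"
proof -
  let ?R = "lcb_truncation n P"
  let ?ind = "\<lambda>y :: nat \<times> 'd. if fst y = n then 1 else 0 :: real"
  note R = stochastic_lcb_truncation[OF P, of n]
  have pv: "prob_vec \<mu>"
    using \<mu> by (rule stationary_prob_imp_prob_vec)
  have ind: "\<bar>?ind y\<bar> \<le> 1" for y
    by simp
  have s: "(\<lambda>x. \<mu> x * g x) summable_on UNIV" if "\<And>x. \<bar>g x\<bar> \<le> 2" for g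
    using expect_summable_bounded[OF pv that] .
  have bd: "\<bar>transition ?R f x\<bar> \<le> 1" "\<bar>transition P f x\<bar> \<le> 1" "\<bar>transition ?R ?ind x\<bar> \<le> 1" for x
    using abs_transition_le[OF R f] abs_transition_le[OF P f] abs_transition_le[OF R ind] by auto
  then have bd': "\<bar>transition ?R f x\<bar> \<le> 2" "\<bar>transition P f x\<bar> \<le> 2"
    "\<bar>transition ?R f x - transition P f x\<bar> \<le> 2" "\<bar>2 * transition ?R ?ind x\<bar> \<le> 2" for x
    using bd[of x] by linarith+
  have "expect \<mu> f - expect \<mu> (transition P f) = expect \<mu> (\<lambda>x. transition ?R f x - transition P f x)"
    using expect_stationary[OF R \<mu> f] expect_diff[OF s[OF bd'(1)] s[OF bd'(2)]]
    by (simp add: transition_def[abs_def])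
  also have "\<bar>\<dots>\<bar> \<le> expect \<mu> (\<lambda>x. 2 * transition ?R ?ind x)"
    using abs_expect_lcb_truncation_diff_le[OF P f, where n = n]
    by (intro abs_expect_le_expect[OF pv s[OF bd'(3)] s[OF bd'(4)]]) (simp add: transition_def)
  also have "\<dots> = 2 * expect \<mu> (\<lambda>x. if fst x \<in> {n} then 1 else 0)"
    using expect_stationary[OF R \<mu> ind] by (simp add: expect_cmult transition_def[abs_def])
  also have "\<dots> = 2 * (\<Sum>j\<in>UNIV. \<mu> (n, j))"
    by (subst expect_level[OF pv]) simp
  finally show ?thesis .
qed

text \<open>Telescoping: every iterate is again bounded by 1, so each step costs the same.\<close>

lemma abs_expect_transition_funpow_diff_le:
  fixes P :: "('d::finite) mat_F"
  assumes P: "stochastic P" and \<mu>: "stationary_prob (lcb_truncation n P) \<mu>" and f: "\<And>x. \<bar>f x\<bar> \<le> 1"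
  shows "\<bar>expect \<mu> f - expect \<mu> ((transition P ^^ t) f)\<bar> \<le> 2 * real t * (\<Sum>j\<in>UNIV. \<mu> (n, j))"
proof (induction t)
  case (Suc t)
  have "\<bar>expect \<mu> ((transition P ^^ t) f) - expect \<mu> (transition P ((transition P ^^ t) f))\<bar>
      \<le> 2 * (\<Sum>j\<in>UNIV. \<mu> (n, j))"
    using abs_transition_funpow_le[OF P f] by (intro abs_expect_transition_diff_le[OF P \<mu>])
  with Suc show ?case
    by (simp add: algebra_simps)
qed simp

subsection \<open>Monotone envelopes\<close>

text \<open>
  Majorants of \<open>h\<close> and \<open>- h\<close> replace a
  coupling of the chains started in \<open>(k, i)\<close> and \<open>(0, i)\<close>: the dominating chain transports both, and
  the gap between them closes when that chain reaches level \<open>0\<close>.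
\<close>

definition envelope :: "('d::finite) vec_F \<Rightarrow> 'd vec_F \<Rightarrow> bool" where
  "envelope h U \<longleftrightarrow>
     level_mono U \<and> (\<forall>x. h x \<le> U x) \<and> (\<forall>x. \<bar>U x\<bar> \<le> 1) \<and> (\<forall>i. U (0, i) = h (0, i))"

text \<open>Domination makes \<open>transition Q U\<close> a majorant, and monotonicity of
  \<open>Q\<close> keeps it increasing in the level. Resetting it on level 0 to the exact value only
  lowers it there, so it remains increasing.\<close>

lemma envelope_step:
  fixes P Q :: "('d::finite) mat_F"
  assumes P: "stochastic P" and Q: "stochastic Q"
    and Q_mono: "\<And>k i. row_dominated (Q (k, i)) (Q (Suc k, i))"
    and dom: "\<And>x. row_dominated (P x) (Q x)"
    and h: "\<And>x. \<bar>h x\<bar> \<le> 1" and env: "envelope h U"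
  shows "envelope (transition P h)
    (\<lambda>x. if fst x = 0 then transition P h x else transition Q U x)"
proof -
  have U: "level_mono U" "\<And>x. h x \<le> U x" "\<And>x. \<bar>U x\<bar> \<le> 1"
    using env by (auto simp: envelope_def)
  have pv: "prob_vec (P x)" "prob_vec (Q x)" for x
    using P Q by (auto intro: stochastic_prob_vec)
  have le: "transition P h x \<le> transition Q U x" for x
  proof -
    have "transition P h x \<le> transition P U x"
      unfolding transition_def using expect_mono[OF pv(1) h U(3,2)] .
    also have "\<dots> \<le> transition Q U x"
      unfolding transition_def using expect_level_mono_le[OF pv dom U(1,3)] .
    finally show ?thesis .
  qed
  have step: "transition Q U (k, i) \<le> transition Q U (Suc k, i)" for k i
    unfolding transition_def using expect_level_mono_le[OF pv(2) pv(2) Q_mono U(1,3)] .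
  show ?thesis
    unfolding envelope_def level_mono_def
    using le step order_trans[OF le step] abs_transition_le[OF P, of h 1]
      abs_transition_le[OF Q, of U 1] h U(3)
    by auto
qed

text \<open>The gap \<open>U x + W x\<close> vanishes on level 0, since \<open>U\<close> and
  \<open>W\<close> take opposite values there. On positive levels one step transports the gap by
  \<open>Q\<close>, and the drift contracts its bound by the factor \<open>\<gamma>\<close>.\<close>

lemma envelopes_funpow:
  fixes P Q :: "('d::finite) mat_F"
  assumes P: "stochastic P" and Q: "stochastic Q"
    and Q_mono: "\<And>k i. row_dominated (Q (k, i)) (Q (Suc k, i))"
    and dom: "\<And>x. row_dominated (P x) (Q x)"
    and g: "\<And>x. \<bar>g x\<bar> \<le> 1" and \<gamma>: "0 \<le> \<gamma>" and v: "\<And>x. 1 \<le> v x"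
    and v_sum: "\<And>x. (\<lambda>y. Q x y * v y) summable_on UNIV"
    and drift: "\<And>k i. 0 < k \<Longrightarrow> transition Q v (k, i) \<le> \<gamma> * v (k, i)"
  shows "\<exists>U W. envelope ((transition P ^^ m) g) U \<and> envelope (\<lambda>x. - (transition P ^^ m) g x) W \<and>
    (\<forall>x. U x + W x \<le> 2 * \<gamma> ^ m * v x)"
proof (induction m)
  case 0
  show ?case
  proof (intro exI conjI allI)
    \<comment> \<open>The constant 1 off level 0 is the crudest admissible majorant; the gap is then
      at most 2, hence at most \<open>2 * v x\<close>.\<close>
    show "envelope ((transition P ^^ 0) g) (\<lambda>x. if fst x = 0 then g x else 1)"
      "envelope (\<lambda>x. - (transition P ^^ 0) g x) (\<lambda>x. if fst x = 0 then - g x else 1)"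
      using g by (auto simp: envelope_def level_mono_def abs_le_iff minus_le_iff)
    show "(if fst x = 0 then g x else 1) + (if fst x = 0 then - g x else 1) \<le> 2 * \<gamma> ^ 0 * v x" for x
      using v[of x] by simp
  qed
next
  case (Suc m)
  define h where "h = (transition P ^^ m) g"
  have h: "\<bar>h x\<bar> \<le> 1" "\<bar>- h x\<bar> \<le> 1" for x
    using abs_transition_funpow_le[OF P g] by (simp_all add: h_def)
  obtain U W where U: "envelope h U" and W: "envelope (\<lambda>x. - h x) W"
    and gap: "\<And>x. U x + W x \<le> 2 * \<gamma> ^ m * v x"
    using Suc.IH by (auto simp: h_def)
  have neg: "transition P (\<lambda>x. - h x) x = - transition P h x" for x
    by (simp add: transition_def expect_uminus)
  have bd: "\<bar>U x\<bar> \<le> 1" "\<bar>W x\<bar> \<le> 1" "\<bar>U x + W x\<bar> \<le> 2" for x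
  proof -
    show *: "\<bar>U x\<bar> \<le> 1" "\<bar>W x\<bar> \<le> 1"
      using U W by (simp_all only: envelope_def)
    then show "\<bar>U x + W x\<bar> \<le> 2"
      by linarith
  qed
  have gap': "transition Q U x + transition Q W x \<le> 2 * \<gamma> ^ Suc m * v x" if "0 < fst x" for x
  proof -
    have pv: "prob_vec (Q x)"
      using Q by (rule stochastic_prob_vec)
    have "(\<lambda>y. Q x y * (2 * \<gamma> ^ m * v y)) = (\<lambda>y. 2 * \<gamma> ^ m * (Q x y * v y))"
      by (simp add: mult_ac)
    then have s: "(\<lambda>y. Q x y * (2 * \<gamma> ^ m * v y)) summable_on UNIV"
      using v_sum[of x] by (simp add: summable_on_cmult_right)
    have "transition Q U x + transition Q W x = expect (Q x) (\<lambda>y. U y + W y)"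
      unfolding transition_def
      using expect_add[OF expect_summable_bounded[OF pv bd(1)] expect_summable_bounded[OF pv bd(2)]]
      by simp
    also have "\<dots> \<le> expect (Q x) (\<lambda>y. 2 * \<gamma> ^ m * v y)"
      using expect_mono_summable[OF pv expect_summable_bounded[OF pv bd(3)] s gap] .
    also have "\<dots> = 2 * \<gamma> ^ m * transition Q v x"
      by (simp add: expect_cmult transition_def)
    also have "\<dots> \<le> 2 * \<gamma> ^ m * (\<gamma> * v x)"
      using drift[of "fst x" "snd x"] that \<gamma> by (intro mult_left_mono) auto
    finally show ?thesis
      by (simp add: mult_ac)
  qed
  let ?V = "\<lambda>h V x. if fst x = 0 then transition P h x else transition Q V x"
  have "envelope (transition P h) (?V h U)"
    by (rule envelope_step[OF P Q Q_mono dom h(1) U])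
  moreover have "envelope (transition P (\<lambda>x. - h x)) (?V (\<lambda>x. - h x) W)"
    by (rule envelope_step[OF P Q Q_mono dom h(2) W])
  moreover have "?V h U x + ?V (\<lambda>x. - h x) W x \<le> 2 * \<gamma> ^ Suc m * v x" for x
  proof (cases "fst x = 0")
    case True
    have "0 \<le> v x"
      using v[of x] by simp
    then have "0 \<le> 2 * \<gamma> ^ Suc m * v x"
      using \<gamma> by simp
    then show ?thesis
      using True by (simp add: neg)
  next
    case False
    then show ?thesis
      using gap'[of x] by simp
  qed
  ultimately show ?case
    unfolding funpow.simps comp_def h_def[symmetric] neg by blast
qed

text \<open>Writing \<open>h\<close> for the iterate, adding \<open>h (k, i) \<le> U (k, i)\<close>
  and \<open>- h (0, i) \<le> W (k, i)\<close> bounds the difference by the gap. Exchanging the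
  roles of \<open>U\<close> and \<open>W\<close> gives the other sign.\<close>

lemma abs_transition_funpow_diff_level_0_le:
  fixes P Q :: "('d::finite) mat_F"
  assumes "stochastic P" and "stochastic Q"
    and "\<And>k i. row_dominated (Q (k, i)) (Q (Suc k, i))"
    and "\<And>x. row_dominated (P x) (Q x)"
    and "\<And>x. \<bar>g x\<bar> \<le> 1" and "0 \<le> \<gamma>" and "\<And>x. 1 \<le> v x"
    and "\<And>x. (\<lambda>y. Q x y * v y) summable_on UNIV"
    and "\<And>k i. 0 < k \<Longrightarrow> transition Q v (k, i) \<le> \<gamma> * v (k, i)"
  shows "\<bar>(transition P ^^ m) g x - (transition P ^^ m) g (0, snd x)\<bar> \<le> 2 * \<gamma> ^ m * v x"
proof -
  define h where "h = (transition P ^^ m) g"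
  obtain U W where U: "envelope h U" and W: "envelope (\<lambda>x. - h x) W"
    and gap: "\<And>x. U x + W x \<le> 2 * \<gamma> ^ m * v x"
    using envelopes_funpow[where P = P and Q = Q and g = g and v = v and m = m] assms
    unfolding h_def by blast
  obtain k i where x: "x = (k, i)"
    by fastforce
  have "h (0, i) \<le> U (k, i)" "- h (0, i) \<le> W (k, i)"
    using U W level_monoD[of U 0 k i] level_monoD[of W 0 k i] by (auto simp: envelope_def)
  moreover have "h (k, i) \<le> U (k, i)" "- h (k, i) \<le> W (k, i)"
    using U W by (auto simp: envelope_def)
  ultimately show ?thesis
    using gap[of "(k, i)"] by (simp add: x h_def[symmetric] abs_le_iff)
qed

subsection \<open>Phase marginals\<close>

text \<open>As the row marginals depend on the phase alone, the phase process is itself a Markov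
  chain with matrix \<open>\<psi>\<close>. Its invariance equation is stationarity tested on the
  indicator of phase \<open>j\<close>.\<close>

lemma phase_mass_stationary:
  fixes R :: "('d::finite) mat_F"
  assumes R: "stochastic R" and \<mu>: "stationary_prob R \<mu>"
    and \<psi>: "\<And>k i. phase_mass (R (k, i)) = \<psi> i"
  shows "phase_mass \<mu> j = (\<Sum>i\<in>UNIV. phase_mass \<mu> i * \<psi> i j)"
proof -
  let ?c = "\<lambda>i. if i = j then 1 else 0 :: real"
  have pv: "prob_vec \<mu>" "\<And>x. prob_vec (R x)"
    using stationary_prob_imp_prob_vec[OF \<mu>] R by (auto intro: stochastic_prob_vec)
  have row: "expect (R x) (\<lambda>y. ?c (snd y)) = \<psi> (snd x) j" for x
    using expect_phase[OF pv(2), of x ?c] \<psi>[of "fst x" "snd x"]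
    by (simp add: if_distrib cong: if_cong)
  have "phase_mass \<mu> j = expect \<mu> (\<lambda>y. ?c (snd y))"
    using expect_phase[OF pv(1), of ?c] by (simp add: if_distrib cong: if_cong)
  also have "\<dots> = expect \<mu> (\<lambda>x. \<psi> (snd x) j)"
    using expect_stationary[OF R \<mu>, of "\<lambda>y. ?c (snd y)" 1] by (simp add: row)
  also have "\<dots> = (\<Sum>i\<in>UNIV. phase_mass \<mu> i * \<psi> i j)"
    by (rule expect_phase[OF pv(1)])
  finally show ?thesis .
qed

lemma mat_power_nonneg: "stochastic P \<Longrightarrow> 0 \<le> mat_power P n x y"
  by (induction n arbitrary: x) (auto simp: stochastic_def intro!: infsum_nonneg mult_nonneg_nonneg)

text \<open>Positivity of an invariant vector spreads along a path of the chain: a step with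
  \<open>0 < P x z\<close> has \<open>0 < \<psi> (snd x) (snd z)\<close>, so invariance passes
  positivity from the phase of \<open>x\<close> to that of \<open>z\<close>.\<close>

lemma phase_positive_reachable:
  fixes P :: "('d::finite) mat_F"
  assumes P: "stochastic P" and \<psi>: "\<And>k i. phase_mass (P (k, i)) = \<psi> i"
    and a0: "\<And>i. 0 \<le> a i" and a: "\<And>j. a j = (\<Sum>i\<in>UNIV. a i * \<psi> i j)"
    and "0 < mat_power P n x y" and "0 < a (snd x)"
  shows "0 < a (snd y)"
  using assms(5,6)
proof (induction n arbitrary: x)
  case 0
  then show ?case
    by (simp split: if_splits)
next
  case (Suc n)
  have pv: "prob_vec (P x)" for x
    using P by (rule stochastic_prob_vec)
  have "\<exists>z. P x z * mat_power P n z y \<noteq> 0"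
  proof (rule ccontr)
    assume "\<nexists>z. P x z * mat_power P n z y \<noteq> 0"
    then have "(\<lambda>z. P x z * mat_power P n z y) = (\<lambda>_. 0)"
      by blast
    then show False
      using Suc.prems(1) by simp
  qed
  then obtain z where z: "P x z \<noteq> 0" "mat_power P n z y \<noteq> 0"
    by auto
  have \<psi>0: "0 \<le> \<psi> i j" for i j
    using phase_mass_nonneg[OF pv, of "(0, i)" j] \<psi> by simp
  have "0 < P x z"
    using z(1) prob_vec_nonneg[OF pv, of x z] by simp
  then have "0 < \<psi> (snd x) (snd z)"
    using phase_mass_ge[OF pv, of x "fst z" "snd z"] \<psi>[of "fst x" "snd x"] by simp
  then have "0 < a (snd x) * \<psi> (snd x) (snd z)"
    using Suc.prems(2) by simp
  also have "\<dots> \<le> (\<Sum>i\<in>UNIV. a i * \<psi> i (snd z))"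
    by (rule member_le_sum) (use a0 \<psi>0 in auto)
  also have "\<dots> = a (snd z)"
    by (rule a[symmetric])
  finally have "0 < a (snd z)" .
  moreover have "0 < mat_power P n z y"
    using z(2) mat_power_nonneg[OF P, of n z y] by simp
  ultimately show ?case
    using Suc.IH by blast
qed

text \<open>The positive part of the difference of two invariant vectors is again invariant.\<close>

lemma phase_invariant_unique:
  fixes P :: "('d::finite) mat_F"
  assumes P: "stochastic P" and irr: "irreducible_chain P"
    and \<psi>: "\<And>k i. phase_mass (P (k, i)) = \<psi> i"
    and a: "\<And>j. a j = (\<Sum>i\<in>UNIV. a i * \<psi> i j)" and c: "\<And>j. c j = (\<Sum>i\<in>UNIV. c i * \<psi> i j)"
    and total: "(\<Sum>i\<in>UNIV. a i) = (\<Sum>i\<in>UNIV. c i)"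
  shows "a = c"
proof (rule ccontr)
  assume neq: "a \<noteq> c"
  have pv: "prob_vec (P x)" for x
    using P by (rule stochastic_prob_vec)
  have \<psi>0: "0 \<le> \<psi> i j" and \<psi>1: "(\<Sum>j\<in>UNIV. \<psi> i j) = 1" for i j
    using phase_mass_nonneg[OF pv, of "(0, i)" j] sum_phase_mass[OF pv, of "(0, i)"] \<psi> by auto
  define z where "z = (\<lambda>i. max 0 (a i - c i))"
  have z_le: "z j \<le> (\<Sum>i\<in>UNIV. z i * \<psi> i j)" for j
  proof -
    have "a j - c j = (\<Sum>i\<in>UNIV. (a i - c i) * \<psi> i j)"
      using a[of j] c[of j] by (simp add: left_diff_distrib sum_subtractf)
    also have "\<dots> \<le> (\<Sum>i\<in>UNIV. z i * \<psi> i j)"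
      using \<psi>0 by (intro sum_mono mult_right_mono) (auto simp: z_def)
    finally show ?thesis
      using \<psi>0 by (auto simp: z_def intro!: sum_nonneg)
  qed
  \<comment> \<open>The rows of \<open>\<psi>\<close> sum to 1, so both sides of \<open>z_le\<close>
    have the same total, and the entrywise inequality must be an equality.\<close>
  have "(\<Sum>j\<in>UNIV. \<Sum>i\<in>UNIV. z i * \<psi> i j) = (\<Sum>i\<in>UNIV. z i)"
    by (subst sum.swap) (simp add: sum_distrib_left[symmetric] \<psi>1)
  then have z_inv: "z j = (\<Sum>i\<in>UNIV. z i * \<psi> i j)" for j
    using sum_mono_inv[of z UNIV "\<lambda>j. \<Sum>i\<in>UNIV. z i * \<psi> i j" j] z_le by auto
  \<comment> \<open>Distinct vectors with equal totals differ in both directions. Thus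
    \<open>z\<close> is positive at some phase \<open>i\<close> and zero at some phase
    \<open>j\<close>, although \<open>j\<close> is reachable from \<open>i\<close>.\<close>
  have "\<exists>i. c i < a i"
  proof (rule ccontr)
    assume "\<nexists>i. c i < a i"
    then have "a i = c i" for i
      using sum_mono_inv[of a UNIV c i] total by (auto simp: not_less)
    with neq show False
      by auto
  qed
  then obtain i where i: "c i < a i" ..
  have "\<exists>j. a j < c j"
  proof (rule ccontr)
    assume "\<nexists>j. a j < c j"
    then have "c i = a i" for i
      using sum_mono_inv[of c UNIV a i] total by (auto simp: not_less)
    with neq show False
      by auto
  qed
  then obtain j where j: "a j < c j" ..
  obtain n where "0 < mat_power P n (0, i) (0, j)"
    using irr unfolding irreducible_chain_def by blast
  then have "0 < z (snd (0 :: nat, j))"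
    using phase_positive_reachable[OF P \<psi> _ z_inv] i by (force simp: z_def)
  then show False
    using j by (simp add: z_def)
qed


text \<open>Both marginals are invariant under \<open>\<psi>\<close>, and uniqueness is drawn from
  the irreducibility of \<open>P\<close>. The role of \<open>R\<close> will be played by the
  truncation, which never enters the levels above \<open>n\<close> and so is not
  irreducible.\<close>

lemma stationary_phase_mass_unique:
  fixes P R :: "('d::finite) mat_F"
  assumes P: "stochastic P" and irr: "irreducible_chain P" and R: "stochastic R"
    and \<psi>: "\<And>k i. phase_mass (P (k, i)) = \<psi> i" "\<And>k i. phase_mass (R (k, i)) = \<psi> i"
    and \<mu>: "stationary_prob P \<mu>" and \<nu>: "stationary_prob R \<nu>"
  shows "phase_mass \<nu> = phase_mass \<mu>"
proof (rule phase_invariant_unique[OF P irr \<psi>(1)])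
  show "phase_mass \<nu> j = (\<Sum>i\<in>UNIV. phase_mass \<nu> i * \<psi> i j)" for j
    by (rule phase_mass_stationary[OF R \<nu> \<psi>(2)])
  show "phase_mass \<mu> j = (\<Sum>i\<in>UNIV. phase_mass \<mu> i * \<psi> i j)" for j
    by (rule phase_mass_stationary[OF P \<mu> \<psi>(1)])
qed (simp add: sum_phase_mass stationary_prob_imp_prob_vec[OF \<mu>] stationary_prob_imp_prob_vec[OF \<nu>])

text \<open>The reference value depends on \<open>\<mu>\<close> only through its phase marginal, so
  two vectors with equal marginals are compared with the same number.\<close>

lemma abs_expect_diff_level_0_le:
  fixes \<mu> :: "('d::finite) vec_F"
  assumes pv: "prob_vec \<mu>" and v: "(\<lambda>x. \<mu> x * v x) summable_on UNIV"
    and h: "\<And>x. \<bar>h x\<bar> \<le> 1" and diff: "\<And>x. \<bar>h x - h (0, snd x)\<bar> \<le> c * v x"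
  shows "\<bar>expect \<mu> h - (\<Sum>i\<in>UNIV. phase_mass \<mu> i * h (0, i))\<bar> \<le> c * expect \<mu> v"
proof -
  have s: "(\<lambda>x. \<mu> x * h x) summable_on UNIV" "(\<lambda>x. \<mu> x * h (0, snd x)) summable_on UNIV"
    using expect_summable_bounded[OF pv h] expect_summable_bounded[OF pv, of "\<lambda>x. h (0, snd x)" 1] h
    by auto
  have "\<bar>h x - h (0, snd x)\<bar> \<le> 2" for x
    using h[of x] h[of "(0, snd x)"] by linarith
  then have sd: "(\<lambda>x. \<mu> x * (h x - h (0, snd x))) summable_on UNIV"
    by (rule expect_summable_bounded[OF pv])
  have "(\<lambda>x. \<mu> x * (c * v x)) = (\<lambda>x. c * (\<mu> x * v x))"
    by (simp add: mult_ac)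
  then have sv: "(\<lambda>x. \<mu> x * (c * v x)) summable_on UNIV"
    using v by (simp add: summable_on_cmult_right)
  have "expect \<mu> h - (\<Sum>i\<in>UNIV. phase_mass \<mu> i * h (0, i)) = expect \<mu> (\<lambda>x. h x - h (0, snd x))"
    using expect_phase[OF pv, of "\<lambda>i. h (0, i)"] expect_diff[OF s] by simp
  also have "\<bar>\<dots>\<bar> \<le> c * expect \<mu> v"
    using abs_expect_le_expect[OF pv sd sv diff] by (simp add: expect_cmult)
  finally show ?thesis .
qed

section \<open>The drift condition for the shifted weight\<close>

lemma row_dominated_levels:
  fixes Q :: "('d::finite) mat_F"
  assumes "\<And>k i. row_dominated (Q (k, i)) (Q (Suc k, i))" and "k \<le> l"
  shows "row_dominated (Q (k, i)) (Q (l, i))"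
  using assms(2) by (induction rule: dec_induct) (auto intro: row_dominated_refl row_dominated_trans assms(1))

text \<open>
  Adding \<open>B\<close> above level \<open>0\<close> costs \<open>B\<close> times the probability of not jumping to level \<open>0\<close>. Since that
  probability increases with the level, the choice of \<open>B\<close> absorbs \<open>b'\<close> on the levels \<open>1, \<dots>, K\<close>.
\<close>

lemma drift_shift:
  fixes Q :: "('d::finite) mat_F"
  assumes Q: "stochastic Q" and Q_mono: "\<And>k i. row_dominated (Q (k, i)) (Q (Suc k, i))"
    and v': "\<And>x. 1 \<le> v' x" and \<gamma>': "\<gamma>' < 1" and b': "0 \<le> b'" and B: "0 \<le> B"
    and drift: "mat_vec_le Q v' (\<lambda>x. \<gamma>' * v' x + b' * ind_upto K x)"
    and B_ge: "\<And>i. b' \<le> B * (\<Sum>j\<in>UNIV. Q (K, i) (0, j))"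
    and v: "v = (\<lambda>(k, i). if k = 0 then v' (0, i) else v' (k, i) + B)"
    and \<gamma>: "\<gamma> = (\<gamma>' + B) / (1 + B)"
  shows "(\<lambda>y. Q x y * v y) summable_on UNIV"
    and "transition Q v x \<le> \<gamma> * v x + (if fst x = 0 then b' + B else 0)"
proof -
  have pv: "prob_vec (Q x)" for x
    using Q by (rule stochastic_prob_vec)
  \<comment> \<open>The indicator of the positive levels, so that \<open>v\<close> is
    \<open>v'\<close> plus \<open>B\<close> times \<open>f\<close>.\<close>
  define f where "f = (\<lambda>y :: nat \<times> 'd. if fst y = 0 then 0 else 1 :: real)"
  have f: "\<bar>f y\<bar> \<le> 1" "level_mono f" for y
    by (auto simp: f_def level_mono_def)
  have f_eq: "expect (Q x) f = 1 - (\<Sum>j\<in>UNIV. Q x (0, j))" for x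
  proof -
    let ?g = "\<lambda>y :: nat \<times> 'd. if fst y \<in> {0} then 1 else 0 :: real"
    have g: "\<bar>?g y\<bar> \<le> 1" for y
      by simp
    have "(\<lambda>y. f y + ?g y) = (\<lambda>_. 1)"
      by (auto simp: f_def)
    then have "expect (Q x) f + expect (Q x) ?g = 1"
      using expect_add[of "Q x" f ?g] expect_summable_bounded[OF pv f(1)] expect_summable_bounded[OF pv g]
        expect_const[OF pv, of x 1] by simp
    then show ?thesis
      by (subst (asm) expect_level[OF pv]) simp
  qed
  have f_le: "expect (Q x) f \<le> 1" for x
    using f_eq[of x] prob_vec_nonneg[OF pv, of x] by (simp add: sum_nonneg)
  have s': "(\<lambda>y. Q x y * v' y) summable_on UNIV"
    and d': "expect (Q x) v' \<le> \<gamma>' * v' x + b' * ind_upto K x" for x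
    using drift unfolding mat_vec_le_def expect_def by blast+
  have v_eq: "v = (\<lambda>y. v' y + B * f y)"
    by (auto simp: v f_def)
  have "(\<lambda>y. Q x y * (B * f y)) = (\<lambda>y. B * (Q x y * f y))" for x
    by (simp add: mult_ac)
  then have sB: "(\<lambda>y. Q x y * (B * f y)) summable_on UNIV" for x
    using expect_summable_bounded[OF pv f(1), of x] by (simp add: summable_on_cmult_right)
  show "(\<lambda>y. Q x y * v y) summable_on UNIV"
    using summable_on_add[OF s' sB] by (simp add: v_eq distrib_left)
  have tv: "transition Q v x = expect (Q x) v' + B * expect (Q x) f"
    using expect_add[OF s' sB, of x] by (simp add: v_eq transition_def expect_cmult)
  \<comment> \<open>\<open>\<gamma>\<close> is the mean of \<open>\<gamma>'\<close> and 1 with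
    weights proportional to 1 and \<open>B\<close>.\<close>
  have "\<gamma>' \<le> \<gamma>"
    using \<gamma>' B mult_left_mono[of \<gamma>' 1 B] by (simp add: \<gamma> field_simps)
  then have \<gamma>v': "\<gamma>' * v' x \<le> \<gamma> * v' x"
    using v'[of x] by (intro mult_right_mono) auto
  show "transition Q v x \<le> \<gamma> * v x + (if fst x = 0 then b' + B else 0)"
  proof (cases "fst x = 0")
    case True
    have "B * expect (Q x) f \<le> B"
      using mult_left_mono[OF f_le B] by simp
    moreover have "b' * ind_upto K x \<le> b'"
      using b' by (auto simp: ind_upto_def split: prod.split)
    moreover have "v x = v' x"
      using True by (simp add: v_eq f_def)
    ultimately show ?thesis
      using True tv d'[of x] \<gamma>v' by simp
  next
    case False
    have "b' * ind_upto K x + B * expect (Q x) f \<le> B"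
    proof (cases "fst x \<le> K")
      case True
      have "expect (Q x) f \<le> expect (Q (K, snd x)) f"
        using expect_level_mono_le[OF pv pv row_dominated_levels[OF Q_mono True] f(2,1)]
        by (metis prod.collapse)
      then have "B * expect (Q x) f \<le> B * expect (Q (K, snd x)) f"
        using B by (rule mult_left_mono)
      also have "\<dots> \<le> B - b'"
        using B_ge[of "snd x"] by (simp add: f_eq algebra_simps)
      finally show ?thesis
        using True by (simp add: ind_upto_def case_prod_beta)
    next
      case False
      then show ?thesis
        using mult_left_mono[OF f_le[of x] B] by (simp add: ind_upto_def case_prod_beta)
    qed
    then have "transition Q v x \<le> \<gamma>' * v' x + B"
      using tv d'[of x] by simp
    \<comment> \<open>This dictates the value of \<open>\<gamma>\<close>: after multiplication by
      \<open>1 + B\<close> the sides differ by \<open>(v' x - 1) * (B * (1 - \<gamma>'))\<close>,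
      which is 0 when \<open>v' x = 1\<close>.\<close>
    also have "\<gamma>' * v' x + B \<le> \<gamma> * (v' x + B)"
    proof -
      have "0 \<le> (v' x - 1) * (B * (1 - \<gamma>'))"
        using v'[of x] B \<gamma>' by simp
      then have "(\<gamma>' * v' x + B) * (1 + B) \<le> (\<gamma>' + B) * (v' x + B)"
        by (simp add: algebra_simps)
      then show ?thesis
        using B by (simp add: \<gamma> pos_le_divide_eq)
    qed
    finally show ?thesis
      using False by (simp add: v_eq f_def)
  qed
qed

section \<open>The error bound\<close>

theorem theorem4p2:
  fixes P Pt :: "('d::finite) mat_F"
    and \<pi> \<pi>n v' v :: "'d vec_F"
    and \<gamma>' b' B \<gamma> b :: real
    and K n m :: nat
  assumes "stochastic P" and "irreducible_chain P" and "positive_recurrent P"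
    and "stochastic Pt" and "irreducible_chain Pt" and "positive_recurrent Pt"
    and "stationary_prob P \<pi>"
    and "block_monotone Pt"
    and "block_dominated P Pt"
    and "\<And>k i. 1 \<le> v' (k, i)"
    and "\<And>k i. v' (k, i) \<le> v' (Suc k, i)"
    and "0 < \<gamma>'" and "\<gamma>' < 1"
    and "0 < b'"
    and "mat_vec_le Pt v' (\<lambda>x. \<gamma>' * v' x + b' * ind_upto K x)"
    and "\<And>i. 0 < (\<Sum>j\<in>UNIV. Pt (K, i) (0, j))"
    and "0 < B"
    and "\<And>i. b' \<le> B * (\<Sum>j\<in>UNIV. Pt (K, i) (0, j))"
    and "\<gamma> = (\<gamma>' + B) / (1 + B)"
    and "b = b' + B"
    and "v = (\<lambda>(k, i). if k = 0 then v' (0, i) else v' (k, i) + B)"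
    and "1 \<le> n" and "1 \<le> m"
    and "stationary_prob (lcb_truncation n P) \<pi>n"
  shows "norm_F (\<lambda>x. \<pi>n x - \<pi> x)
           \<le> b / (1 - \<gamma>) * (4 * \<gamma> ^ m + 2 * real m * (\<Sum>i\<in>UNIV. 1 / v (n, i)))"
proof -
  let ?R = "lcb_truncation n P"
  let ?\<beta> = "b / (1 - \<gamma>)"
  note P = assms(1) and Q = assms(4) and \<pi> = assms(7) and \<pi>n = assms(24)
  note R = stochastic_lcb_truncation[OF P, of n]
  have pv: "prob_vec (P x)" "prob_vec (Pt x)" "prob_vec (?R x)" "prob_vec \<pi>" "prob_vec \<pi>n" for x
    using P Q R stationary_prob_imp_prob_vec[OF \<pi>] stationary_prob_imp_prob_vec[OF \<pi>n]
    by (auto intro: stochastic_prob_vec)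
  have Q_mono: "row_dominated (Pt (k, i)) (Pt (Suc k, i))" for k i
    using assms(8) by (auto simp: block_monotone_def row_dominated_def)
  have domP: "row_dominated (P x) (Pt x)" for x
    using assms(9) by (cases x) (auto simp: block_dominated_def row_dominated_def)
  have domR: "row_dominated (?R x) (Pt x)" for x
    using row_dominated_lcb_truncation[OF P] domP by (rule row_dominated_trans)
  have v': "1 \<le> v' x" for x
    using assms(10)[of "fst x" "snd x"] by simp
  have v1: "1 \<le> v x" for x
    using v'[of x] assms(17) by (cases x) (auto simp: assms(21))
  have v_mono: "level_mono v"
    using assms(11,17) by (auto simp: level_mono_def assms(21) intro: add_increasing2)
  have \<gamma>: "0 < \<gamma>" "\<gamma> < 1"
    using assms(12,13,17) by (auto simp: assms(19) field_simps)
  have b: "0 < b"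
    using assms(14,17,20) by simp
  note shift = drift_shift[OF Q Q_mono v' assms(13) less_imp_le[OF assms(14)] less_imp_le[OF assms(17)]
      assms(15,18,21,19)]
  have drift: "transition Pt v x \<le> \<gamma> * v x + b" for x
    using shift(2)[of x] b assms(20) by (auto split: if_splits)
  have drift_pos: "transition Pt v (k, i) \<le> \<gamma> * v (k, i)" if "0 < k" for k i
    using shift(2)[of "(k, i)"] that by simp
  \<comment> \<open>Cutting off at \<open>N\<close> keeps \<open>v\<close> increasing and makes it
    bounded, so domination by \<open>Pt\<close> applies. Stated for general \<open>S\<close>, it
    serves both \<open>P\<close> and its truncation.\<close>
  have trunc_drift: "expect (S x) (\<lambda>y. min (v y) N) \<le> \<gamma> * v x + b"
    if S: "stochastic S" and dom: "\<And>x. row_dominated (S x) (Pt x)" and N: "0 \<le> N"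
    for S :: "'d mat_F" and x N
  proof -
    have bd: "\<bar>min (v y) N\<bar> \<le> N" for y
      using v1[of y] N by (auto simp: min_def)
    have "level_mono (\<lambda>y. min (v y) N)"
      using v_mono unfolding level_mono_def by (blast intro: min.mono order_refl)
    from expect_level_mono_le[OF stochastic_prob_vec[OF S] pv(2) dom this bd]
    have "expect (S x) (\<lambda>y. min (v y) N) \<le> expect (Pt x) (\<lambda>y. min (v y) N)" .
    also have "\<dots> \<le> expect (Pt x) v"
      by (rule expect_mono_summable[OF pv(2) expect_summable_bounded[OF pv(2) bd] shift(1)]) simp
    finally show ?thesis
      using drift[of x] by (simp add: transition_def)
  qed
  have v0: "0 \<le> v x" for x
    using v1[of x] by simp
  note \<pi>_v = stationary_expect_drift[OF P \<pi> \<gamma>(2) less_imp_le[OF b] v0 trunc_drift[OF P domP]]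
  note \<pi>n_v = stationary_expect_drift[OF R \<pi>n \<gamma>(2) less_imp_le[OF b] v0 trunc_drift[OF R domR]]
  \<comment> \<open>A single term of the nonnegative series for \<open>expect \<pi>n v\<close> is at
    most the whole sum.\<close>
  have \<pi>n_le: "\<pi>n (n, j) \<le> ?\<beta> * (1 / v (n, j))" for j
  proof -
    have "\<pi>n (n, j) * v (n, j) \<le> expect \<pi>n v"
      using finite_sum_le_infsum[OF \<pi>n_v(1), of "{(n, j)}"] v0 prob_vec_nonneg[OF pv(5)]
      by (auto simp: expect_def)
    then have "\<pi>n (n, j) * v (n, j) \<le> ?\<beta>"
      using \<pi>n_v(2) by linarith
    moreover have "0 < v (n, j)"
      using v1[of "(n, j)"] by simp
    ultimately have "\<pi>n (n, j) \<le> ?\<beta> / v (n, j)"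
      by (subst pos_le_divide_eq)
    then show ?thesis
      by simp
  qed
  \<comment> \<open>Domination between probability rows preserves phase marginals. Hence all rows of
    \<open>Pt\<close> with the same phase share one marginal, and the rows of \<open>P\<close> and
    of its truncation inherit it.\<close>
  have phase: "phase_mass \<pi>n = phase_mass \<pi>"
  proof (rule stationary_phase_mass_unique[OF P assms(2) R _ _ \<pi> \<pi>n])
    have Pt: "phase_mass (Pt (k, i)) = phase_mass (Pt (0, i))" for k i
      using row_dominated_phase_mass_eq[OF pv(2,2) row_dominated_levels[OF Q_mono, of 0 k i]] by simp
    show "phase_mass (P (k, i)) = phase_mass (Pt (0, i))" for k i
      using row_dominated_phase_mass_eq[OF pv(1,2) domP] Pt by simp
    show "phase_mass (?R (k, i)) = phase_mass (Pt (0, i))" for k i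
      using row_dominated_phase_mass_eq[OF pv(3,2) domR] Pt by simp
  qed
  \<comment> \<open>With this sign vector the norm becomes exactly a difference of two
    expectations.\<close>
  define g where "g x = sgn (\<pi>n x - \<pi> x)" for x
  have g: "\<bar>g x\<bar> \<le> 1" for x
    by (simp add: g_def sgn_if)
  let ?h = "(transition P ^^ m) g"
  have "norm_F (\<lambda>x. \<pi>n x - \<pi> x) = (\<Sum>\<^sub>\<infinity>x. \<pi>n x * g x + - (\<pi> x * g x))"
    unfolding norm_F_def by (rule infsum_cong) (simp add: g_def abs_sgn left_diff_distrib)
  also have "\<dots> = expect \<pi>n g - expect \<pi> g"
    using infsum_add[of "\<lambda>x. \<pi>n x * g x" UNIV "\<lambda>x. - (\<pi> x * g x)"]
      expect_summable_bounded[OF pv(5) g] expect_summable_bounded[OF pv(4) g]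
    by (simp add: expect_def summable_on_uminus infsum_uminus)
  finally have norm: "norm_F (\<lambda>x. \<pi>n x - \<pi> x) = expect \<pi>n g - expect \<pi> g" .
  have "\<bar>expect \<pi>n g - expect \<pi>n ?h\<bar> \<le> 2 * real m * (\<Sum>j\<in>UNIV. \<pi>n (n, j))"
    by (rule abs_expect_transition_funpow_diff_le[OF P \<pi>n g])
  also have "\<dots> \<le> 2 * real m * (\<Sum>j\<in>UNIV. ?\<beta> * (1 / v (n, j)))"
    using \<pi>n_le by (intro mult_left_mono sum_mono) auto
  finally have trunc: "\<bar>expect \<pi>n g - expect \<pi>n ?h\<bar> \<le> ?\<beta> * (2 * real m * (\<Sum>j\<in>UNIV. 1 / v (n, j)))"
    by (simp add: sum_distrib_left mult_ac)
  have h: "\<bar>?h x\<bar> \<le> 1" for x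
    by (rule abs_transition_funpow_le[OF P g])
  have diff: "\<bar>?h x - ?h (0, snd x)\<bar> \<le> 2 * \<gamma> ^ m * v x" for x
    by (rule abs_transition_funpow_diff_level_0_le
        [OF P Q Q_mono domP g less_imp_le[OF \<gamma>(1)] v1 shift(1) drift_pos])
  \<comment> \<open>Used once for \<open>\<pi>n\<close> and once for \<open>\<pi>\<close>, which
    together give the coefficient 4 of \<open>\<gamma> ^ m\<close>.\<close>
  have mix: "\<bar>expect \<mu> ?h - (\<Sum>i\<in>UNIV. phase_mass \<mu> i * ?h (0, i))\<bar> \<le> 2 * \<gamma> ^ m * ?\<beta>"
    if "prob_vec \<mu>" "(\<lambda>x. \<mu> x * v x) summable_on UNIV" "expect \<mu> v \<le> ?\<beta>" for \<mu>
  proof -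
    have "2 * \<gamma> ^ m * expect \<mu> v \<le> 2 * \<gamma> ^ m * ?\<beta>"
      using that(3) \<gamma>(1) by (intro mult_left_mono) auto
    with abs_expect_diff_level_0_le[OF that(1,2) h diff] show ?thesis
      by linarith
  qed
  \<comment> \<open>For \<open>\<pi>\<close> the iteration is exact, so only \<open>\<pi>n\<close>
    incurs a truncation error.\<close>
  have "expect \<pi> ?h = expect \<pi> g"
    by (rule expect_stationary_funpow[OF P \<pi> g])
  with trunc mix[OF pv(5) \<pi>n_v] mix[OF pv(4) \<pi>_v] norm
  have "norm_F (\<lambda>x. \<pi>n x - \<pi> x)
      \<le> 4 * \<gamma> ^ m * ?\<beta> + ?\<beta> * (2 * real m * (\<Sum>j\<in>UNIV. 1 / v (n, j)))"
    unfolding phase by linarith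
  then show ?thesis
    by (simp add: distrib_left mult_ac)
qed

end
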